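(* Let $C,\Delta\in\mathbb{R}^{n\times n}$ be symmetric and let $A = C + \Delta$ and $B = -C + \Delta$. Suppose that $$2 (\Delta_{ij}^2 + \Delta_{kl}^2) \leq \left( C_{ij} - C_{kl} + \Delta_{ij} + \Delta_{kl} \right)^2 = \left( A_{ij} - (-B_{kl}) \right)^2$$ for all $i,j,k,l \in [n]$ such that either ($i \neq j$ and $k \neq l$) or ($i=j$ and $k=l$). Then the tuple $(X,\mathbf{X}) = (I, \mathrm{vec}(I)\, \mathrm{vec}(I)^T)$ is an optimal solution to the semidefinite program $\mathrm{SDP}(A,B)$ defined in the context.
   Context: $[n]=\{1,\dots,n\}$; $I$ is the $n\times n$ identity; $\mathbf{1}\in\mathbb{R}^n$ is the all-ones vector. Rows and columns of $n^2\times n^2$ matrices are indexed by pairs in $[n]\times[n]$ (lexicographic order), so $(A\otimes B)_{(i,k),(j,l)}=A_{ij}B_{kl}$. For $X\in\mathbb{R}^{n\times n}$, $\mathrm{vec}(X)\in\mathbb{R}^{n^2}$ has entries $\mathrm{vec}(X)_{(i,j)}=X_{ij}$. $M\succeq 0$ means $M$ is symmetric positive semidefinite. $\langle P,Q\rangle=\mathrm{tr}(P^TQ)$. $\mathrm{DS}(n)=\{X\in\mathbb{R}^{n\times n}: X\mathbf{1}=\mathbf{1},\ X^T\mathbf{1}=\mathbf{1},\ X\ge 0\}$. $\mathrm{SDP}(A,B)$: minimize $\langle A\otimes B,\mathbf{X}\rangle$ over $\mathbf{X}\in\mathbb{R}^{n^2\times n^2}$ and $X\in\mathbb{R}^{n\times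 n}$ subject to (a) $\begin{pmatrix}\mathbf{X} & \mathrm{vec}(X)\\ \mathrm{vec}(X)^T & 1\end{pmatrix}\succeq 0$; (b) $\sum_{i,j}\mathbf{X}_{(i,k),(j,l)}=1$ and $\sum_{i,j}\mathbf{X}_{(k,i),(l,j)}=1$ for all $k,l\in[n]$; (c) $\mathbf{X}_{(i,k),(j,k)}=0$ and $\mathbf{X}_{(k,i),(k,j)}=0$ for all $k$ and all $i\ne j$; (d) $\mathbf{X}\ge 0$ entrywise; (e) $X\in\mathrm{DS}(n)$. *)

theory Defs
  imports "HOL-Analysis.Analysis"
begin

text \<open>
  The index set [n] is a finite type \<open>'n\<close>, and the index set of the
  n^2 by n^2 matrices is the type \<open>'n \<times> 'n\<close>. In \<open>real^'b^'a\<close> the first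
  index, of type \<open>'a\<close>, is the row.
\<close>

definition psd :: "real^'a^'a \<Rightarrow> bool" where
  "psd M \<longleftrightarrow> transpose M = M \<and> (\<forall>x. 0 \<le> x \<bullet> (M *v x))"

definition mat_inner :: "real^'b^'a \<Rightarrow> real^'b^'a \<Rightarrow> real" where
  "mat_inner P Q = trace (transpose P ** Q)"

definition kronecker :: "real^'n^'n \<Rightarrow> real^'n^'n \<Rightarrow> real^('n \<times> 'n)^('n \<times> 'n)" where
  "kronecker A B = (\<chi> p q. A $ fst p $ fst q * B $ snd p $ snd q)"

text \<open>The name \<open>vec\<close> is taken by the constant vectors of the library.\<close>

definition vectorize :: "real^'n^'n \<Rightarrow> real^('n \<times> 'n)" where
  "vectorize X = (\<chi> p. X $ fst p $ snd p)"

definition outer_product :: "real^'a \<Rightarrow> real^'b \<Rightarrow> real^'b^'a" where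
  "outer_product v w = (\<chi> i j. v $ i * w $ j)"

text \<open>The block matrix with rows \<open>(M, v)\<close> and \<open>(v\<^sup>T, 1)\<close>; the last row and column
  have index \<open>Inr ()\<close>.\<close>

definition bordered :: "real^'a^'a \<Rightarrow> real^'a \<Rightarrow> real^('a + unit)^('a + unit)" where
  "bordered M v = (\<chi> r s.
     case r of
       Inl p \<Rightarrow> (case s of Inl q \<Rightarrow> M $ p $ q | Inr _ \<Rightarrow> v $ p)
     | Inr _ \<Rightarrow> (case s of Inl q \<Rightarrow> v $ q | Inr _ \<Rightarrow> 1))"

text \<open>The numeral \<open>1 :: real^'n\<close> is the all-ones vector (the identity matrix is \<open>mat 1\<close>).\<close>

definition DS :: "(real^'n^'n) set" where
  "DS = {X. X *v 1 = 1 \<and> transpose X *v 1 = 1 \<and> (\<forall>i j. 0 \<le> X $ i $ j)}"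

definition sdp_feasible :: "(real^'n^'n) \<times> (real^('n \<times> 'n)^('n \<times> 'n)) \<Rightarrow> bool" where
  "sdp_feasible = (\<lambda>(X, XX).
     psd (bordered XX (vectorize X)) \<and>
     (\<forall>k l. (\<Sum>i\<in>UNIV. \<Sum>j\<in>UNIV. XX $ (i, k) $ (j, l)) = 1) \<and>
     (\<forall>k l. (\<Sum>i\<in>UNIV. \<Sum>j\<in>UNIV. XX $ (k, i) $ (l, j)) = 1) \<and>
     (\<forall>k i j. i \<noteq> j \<longrightarrow> XX $ (i, k) $ (j, k) = 0) \<and>
     (\<forall>k i j. i \<noteq> j \<longrightarrow> XX $ (k, i) $ (k, j) = 0) \<and>
     (\<forall>p q. 0 \<le> XX $ p $ q) \<and>
     X \<in> DS)"

definition sdp_objective ::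
    "real^'n^'n \<Rightarrow> real^'n^'n \<Rightarrow> (real^'n^'n) \<times> (real^('n \<times> 'n)^('n \<times> 'n)) \<Rightarrow> real" where
  "sdp_objective A B = (\<lambda>(X, XX). mat_inner (kronecker A B) XX)"

definition sdp_optimal ::
    "real^'n^'n \<Rightarrow> real^'n^'n \<Rightarrow> (real^'n^'n) \<times> (real^('n \<times> 'n)^('n \<times> 'n)) \<Rightarrow> bool" where
  "sdp_optimal A B = is_arg_min (sdp_objective A B) sdp_feasible"

end

theory Submission
  imports Defs
begin

text \<open>
  The entries \<open>XX $ (i, k) $ (j, l)\<close> of a feasible matrix form a transport plan between
  the positions \<open>(i, j)\<close> of \<open>A\<close> and the positions \<open>(k, l)\<close> of \<open>B\<close>: they are nonnegative and
  (b) says that both marginals are the all-ones table. Constraint (c) confines the plan to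
  quadruples that pair off-diagonal positions with off-diagonal ones and diagonal positions
  with diagonal ones, exactly those to which the hypothesis on \<open>C\<close> and \<open>\<Delta>\<close> applies.
  So linear-programming duality for transport bounds the objective from below: any
  potentials \<open>u\<close>, \<open>v\<close> with \<open>u i j + v k l \<le> A $ i $ j * B $ k $ l\<close> on these quadruples give
  the lower bound \<open>\<Sum>u + \<Sum>v\<close> (\<open>sdp_weak_duality\<close>).

  The potentials come from completing the square. Since \<open>ab = ((a + b)\<^sup>2 - a\<^sup>2 - b\<^sup>2) / 2\<close> and
  \<open>A $ i $ j + B $ k $ l\<close> is the number squared in the hypothesis, the hypothesis reads
  \<open>A $ i $ j * B $ k $ l \<ge> (\<Delta> $ i $ j)\<^sup>2 - (A $ i $ j)\<^sup>2 / 2 + (\<Delta> $ k $ l)\<^sup>2 - (B $ k $ l)\<^sup>2 / 2\<close>.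
  Because \<open>A\<^sup>2 + B\<^sup>2 = 2 C\<^sup>2 + 2 \<Delta>\<^sup>2\<close> entrywise, the bound that results is
  \<open>\<Sum>(\<Delta>\<^sup>2 - C\<^sup>2) = \<Sum>A $ i $ j * B $ i $ j\<close>, and this is the value of the objective at the identity.
\<close>

lemma sum_UNIV_prod:
  fixes f :: "'a::finite \<times> 'b::finite \<Rightarrow> real"
  shows "(\<Sum>p\<in>UNIV. f p) = (\<Sum>i\<in>UNIV. \<Sum>k\<in>UNIV. f (i, k))"
  by (simp add: sum.cartesian_product flip: UNIV_Times_UNIV)

lemma sdp_objective_eq_sum:
  fixes A B :: "real^'n^'n"
  shows "sdp_objective A B (X, XX) =
    (\<Sum>i\<in>UNIV. \<Sum>j\<in>UNIV. \<Sum>k\<in>UNIV. \<Sum>l\<in>UNIV. A $ i $ j * B $ k $ l * XX $ (i, k) $ (j, l))"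
proof -
  have "sdp_objective A B (X, XX) =
      (\<Sum>q\<in>UNIV. \<Sum>p\<in>UNIV. A $ fst p $ fst q * B $ snd p $ snd q * XX $ p $ q)"
    by (simp add: sdp_objective_def mat_inner_def trace_def transpose_def
        matrix_matrix_mult_def kronecker_def)
  also have "\<dots> = (\<Sum>p\<in>UNIV. \<Sum>q\<in>UNIV. A $ fst p $ fst q * B $ snd p $ snd q * XX $ p $ q)"
    by (rule sum.swap)
  also have "\<dots> = (\<Sum>i\<in>UNIV. \<Sum>k\<in>UNIV. \<Sum>j\<in>UNIV. \<Sum>l\<in>UNIV.
      A $ i $ j * B $ k $ l * XX $ (i, k) $ (j, l))"
    by (simp add: sum_UNIV_prod)
  also have "\<dots> = (\<Sum>i\<in>UNIV. \<Sum>j\<in>UNIV. \<Sum>k\<in>UNIV. \<Sum>l\<in>UNIV.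
      A $ i $ j * B $ k $ l * XX $ (i, k) $ (j, l))"
    by (rule sum.cong[OF refl], rule sum.swap)
  finally show ?thesis .
qed

text \<open>
  Averaging a function of one pair of indices over the transport plan gives its plain sum,
  since the marginals of the plan are constantly one.
\<close>

lemma sdp_feasible_row_marginal:
  assumes "sdp_feasible (X, XX)"
  shows "(\<Sum>i\<in>UNIV. \<Sum>j\<in>UNIV. \<Sum>k\<in>UNIV. \<Sum>l\<in>UNIV. u i j * XX $ (i, k) $ (j, l))
    = (\<Sum>i\<in>UNIV. \<Sum>j\<in>UNIV. u i j)"
proof -
  have "(\<Sum>k\<in>UNIV. \<Sum>l\<in>UNIV. XX $ (i, k) $ (j, l)) = 1" for i j
    using assms by (simp add: sdp_feasible_def)
  then show ?thesis
    by (simp flip: sum_distrib_left)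
qed

lemma sdp_feasible_column_marginal:
  assumes "sdp_feasible (X, XX)"
  shows "(\<Sum>i\<in>UNIV. \<Sum>j\<in>UNIV. \<Sum>k\<in>UNIV. \<Sum>l\<in>UNIV. v k l * XX $ (i, k) $ (j, l))
    = (\<Sum>k\<in>UNIV. \<Sum>l\<in>UNIV. v k l)"
proof -
  have one: "(\<Sum>i\<in>UNIV. \<Sum>j\<in>UNIV. XX $ (i, k) $ (j, l)) = 1" for k l
    using assms by (simp add: sdp_feasible_def)
  have "(\<Sum>i\<in>UNIV. \<Sum>j\<in>UNIV. \<Sum>k\<in>UNIV. \<Sum>l\<in>UNIV. v k l * XX $ (i, k) $ (j, l))
      = (\<Sum>p\<in>UNIV. \<Sum>q\<in>UNIV. v (fst q) (snd q) * XX $ (fst p, fst q) $ (snd p, snd q))"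
    by (simp add: sum_UNIV_prod)
  also have "\<dots> = (\<Sum>q\<in>UNIV. \<Sum>p\<in>UNIV. v (fst q) (snd q) * XX $ (fst p, fst q) $ (snd p, snd q))"
    by (rule sum.swap)
  also have "\<dots> = (\<Sum>k\<in>UNIV. \<Sum>l\<in>UNIV. v k l)"
    by (simp add: sum_UNIV_prod one flip: sum_distrib_left)
  finally show ?thesis .
qed

lemma sdp_feasible_support:
  assumes "sdp_feasible (X, XX)" and "XX $ (i, k) $ (j, l) \<noteq> 0"
  shows "(i \<noteq> j \<and> k \<noteq> l) \<or> (i = j \<and> k = l)"
  using assms unfolding sdp_feasible_def by auto

text \<open>
  Weak duality of the transport problem: weight the inequality between potentials and costs
  by the plan and sum. By (c) the plan vanishes at every quadruple that the inequality does
  not cover.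
\<close>

lemma sdp_weak_duality:
  fixes A B :: "real^'n^'n"
  assumes feas: "sdp_feasible (X, XX)"
    and le: "\<And>i j k l. (i \<noteq> j \<and> k \<noteq> l) \<or> (i = j \<and> k = l) \<Longrightarrow>
      u i j + v k l \<le> A $ i $ j * B $ k $ l"
  shows "(\<Sum>i\<in>UNIV. \<Sum>j\<in>UNIV. u i j) + (\<Sum>k\<in>UNIV. \<Sum>l\<in>UNIV. v k l)
    \<le> sdp_objective A B (X, XX)"
proof -
  have pointwise: "u i j * XX $ (i, k) $ (j, l) + v k l * XX $ (i, k) $ (j, l)
      \<le> A $ i $ j * B $ k $ l * XX $ (i, k) $ (j, l)" for i j k l
  proof (cases "XX $ (i, k) $ (j, l) = 0")
    case False
    have "0 \<le> XX $ (i, k) $ (j, l)"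
      using feas by (simp add: sdp_feasible_def)
    then show ?thesis
      using mult_right_mono[OF le[OF sdp_feasible_support[OF feas False]]]
      by (simp add: distrib_right)
  qed simp
  have "(\<Sum>i\<in>UNIV. \<Sum>j\<in>UNIV. u i j) + (\<Sum>k\<in>UNIV. \<Sum>l\<in>UNIV. v k l)
      = (\<Sum>i\<in>UNIV. \<Sum>j\<in>UNIV. \<Sum>k\<in>UNIV. \<Sum>l\<in>UNIV.
          u i j * XX $ (i, k) $ (j, l) + v k l * XX $ (i, k) $ (j, l))"
    by (simp only: sum.distrib sdp_feasible_row_marginal[OF feas]
        sdp_feasible_column_marginal[OF feas])
  also have "\<dots> \<le> sdp_objective A B (X, XX)"
    unfolding sdp_objective_eq_sum by (intro sum_mono pointwise)
  finally show ?thesis .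
qed

lemma psd_outer_product: "psd (outer_product w w)"
proof -
  have "x \<bullet> (outer_product w w *v x) = (x \<bullet> w)\<^sup>2" for x
    by (simp add: outer_product_def matrix_vector_mult_def inner_vec_def power2_eq_square
        sum_distrib_left sum_distrib_right mult_ac)
  moreover have "transpose (outer_product w w) = outer_product w w"
    by (simp add: outer_product_def transpose_def vec_eq_iff mult.commute)
  ultimately show ?thesis
    by (simp add: psd_def)
qed

text \<open>
  The bordered matrix of a rank-one lift is itself of rank one, with factor \<open>(v, 1)\<close>.
\<close>

lemma psd_bordered_outer_product: "psd (bordered (outer_product v v) v)"
proof -
  define w :: "real^('a + unit)" where "w = (\<chi> r. case r of Inl p \<Rightarrow> v $ p | Inr _ \<Rightarrow> 1)"
  have "bordered (outer_product v v) v = outer_product w w"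
    by (simp add: vec_eq_iff bordered_def outer_product_def w_def split: sum.split)
  then show ?thesis
    by (simp add: psd_outer_product)
qed

lemma identity_in_DS: "(mat 1 :: real^'n^'n) \<in> DS"
  by (simp add: DS_def transpose_mat) (simp add: mat_def)

lemma identity_lift_nth:
  "outer_product (vectorize (mat 1)) (vectorize (mat 1)) $ (i, k) $ (j, l)
    = (if i = k then if j = l then 1 else 0 else 0)"
  by (simp add: outer_product_def vectorize_def mat_def)

lemma sdp_feasible_identity:
  "sdp_feasible (mat 1, outer_product (vectorize (mat 1)) (vectorize (mat 1)))"
  unfolding sdp_feasible_def
  by (auto simp: psd_bordered_outer_product identity_in_DS identity_lift_nth
      if_distrib[of "\<lambda>f. sum f UNIV"] sum.If_cases)

lemma sdp_objective_identity:
  fixes A B :: "real^'n^'n"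
  shows "sdp_objective A B (mat 1, outer_product (vectorize (mat 1)) (vectorize (mat 1)))
    = (\<Sum>i\<in>UNIV. \<Sum>j\<in>UNIV. A $ i $ j * B $ i $ j)"
proof -
  have "(\<Sum>k\<in>UNIV. \<Sum>l\<in>UNIV. A $ i $ j * B $ k $ l *
      (if i = k then if j = l then 1 else 0 else 0)) = A $ i $ j * B $ i $ j" for i j
  proof -
    have "(\<Sum>l\<in>UNIV. A $ i $ j * B $ k $ l * (if i = k then if j = l then 1 else 0 else 0))
        = (if i = k then A $ i $ j * B $ k $ j else 0)" for k
      by (cases "i = k") (simp_all add: if_distrib[of "(*) _"] cong: if_cong)
    then show ?thesis
      by simp
  qed
  then show ?thesis
    by (simp add: sdp_objective_eq_sum identity_lift_nth)
qed

theorem theorem4p1: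
  fixes A B C \<Delta> :: "real^'n^'n"
  assumes "transpose C = C" and "transpose \<Delta> = \<Delta>"
    and "A = C + \<Delta>" and "B = - C + \<Delta>"
    and "\<And>i j k l. (i \<noteq> j \<and> k \<noteq> l) \<or> (i = j \<and> k = l) \<Longrightarrow>
      2 * ((\<Delta> $ i $ j)\<^sup>2 + (\<Delta> $ k $ l)\<^sup>2)
        \<le> (C $ i $ j - C $ k $ l + \<Delta> $ i $ j + \<Delta> $ k $ l)\<^sup>2"
  shows "sdp_optimal A B
    (mat 1, outer_product (vectorize (mat 1)) (vectorize (mat 1)))"
proof -
  let ?I = "(mat 1, outer_product (vectorize (mat 1)) (vectorize (mat 1)))
    :: (real^'n^'n) \<times> (real^('n \<times> 'n)^('n \<times> 'n))"
  define u where "u i j = (\<Delta> $ i $ j)\<^sup>2 - (A $ i $ j)\<^sup>2 / 2" for i j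
  define v where "v k l = (\<Delta> $ k $ l)\<^sup>2 - (B $ k $ l)\<^sup>2 / 2" for k l
  have potentials: "u i j + v k l \<le> A $ i $ j * B $ k $ l"
    if "(i \<noteq> j \<and> k \<noteq> l) \<or> (i = j \<and> k = l)" for i j k l
  proof -
    have "C $ i $ j - C $ k $ l + \<Delta> $ i $ j + \<Delta> $ k $ l = A $ i $ j + B $ k $ l"
      using assms(3,4) by simp
    then have "2 * ((\<Delta> $ i $ j)\<^sup>2 + (\<Delta> $ k $ l)\<^sup>2) \<le> (A $ i $ j + B $ k $ l)\<^sup>2"
      using assms(5)[OF that] by simp
    then show ?thesis
      by (simp add: u_def v_def power2_sum)
  qed
  \<comment> \<open>The identity lift only charges pairs of equal positions; there \<open>\<Delta> = (A + B) / 2\<close> leaves no gap.\<close>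
  have tight: "u i j + v i j = A $ i $ j * B $ i $ j" for i j
    unfolding u_def v_def assms(3,4) by (simp add: power2_eq_square field_simps)
  have lower_bound: "sdp_objective A B ?I \<le> sdp_objective A B Y"
    if feas: "sdp_feasible Y" for Y
  proof -
    obtain X XX where Y: "Y = (X, XX)"
      by fastforce
    have "sdp_objective A B ?I = (\<Sum>i\<in>UNIV. \<Sum>j\<in>UNIV. u i j) + (\<Sum>k\<in>UNIV. \<Sum>l\<in>UNIV. v k l)"
      by (simp add: sdp_objective_identity flip: tight sum.distrib)
    also have "\<dots> \<le> sdp_objective A B Y"
      using sdp_weak_duality[of X XX u v A B] feas potentials unfolding Y by blast
    finally show ?thesis .
  qed
  show ?thesis
    unfolding sdp_optimal_def is_arg_min_def
    using sdp_feasible_identity lower_bound by (auto simp: not_less)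
qed

end
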